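(* Let $I,J,R$ be positive integers, let $E\in\mathbb{R}^{IJ\times R}$ have full column rank $R$, let $\{\mathbf{u}_1,\dots,\mathbf{u}_{IJ-R}\}$ be a basis of $\mathcal{N}(E^\top)=\{\mathbf{u}\in\mathbb{R}^{IJ}: E^\top\mathbf{u}=0\}$, and let $\mathsf{U}_i=\mathrm{vec}^{-1}(\mathbf{u}_i)\in\mathbb{R}^{I\times J}$ for $i=1,\dots,IJ-R$. Let $\tilde{\mathbf{x}}\in\mathbb{R}^I$ and $\tilde{\mathbf{y}}\in\mathbb{R}^J$. Then $\tilde{\mathbf{y}}\otimes\tilde{\mathbf{x}}$ belongs to the column space of $E$ if and only if $(\tilde{\mathbf{x}},\tilde{\mathbf{y}})$ is a solution of the system $$\mathbf{x}^\top\mathsf{U}_i\,\mathbf{y}=0,\qquad i=1,\dots,IJ-R .$$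
   Context: $\otimes$ is the Kronecker product; for vectors $\mathbf{y}\in\mathbb{R}^J$, $\mathbf{x}\in\mathbb{R}^I$, $\mathbf{y}\otimes\mathbf{x}=[y_1\mathbf{x}^\top,\dots,y_J\mathbf{x}^\top]^\top\in\mathbb{R}^{IJ}$. For an $I\times J$ matrix $A=[\mathbf{a}_1,\dots,\mathbf{a}_J]$, $\mathrm{vec}(A)=[\mathbf{a}_1^\top,\dots,\mathbf{a}_J^\top]^\top\in\mathbb{R}^{IJ}$ stacks the columns, and $\mathrm{vec}^{-1}:\mathbb{R}^{IJ}\to\mathbb{R}^{I\times J}$ is its inverse. *)

theory Defs
  imports "Jordan_Normal_Form.DL_Rank" "Jordan_Normal_Form.Matrix_Kernel"
begin

text \<open>All entries are indexed from 0, as usual for \<^typ>\<open>'a vec\<close> and \<^typ>\<open>'a mat\<close>: position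
  k of a stack of blocks of length n lies in block k div n, at offset k mod n.\<close>

definition kron_vec :: "'a :: semiring_1 vec \<Rightarrow> 'a vec \<Rightarrow> 'a vec" where
  "kron_vec y x =
     vec (dim_vec y * dim_vec x) (\<lambda>k. y $ (k div dim_vec x) * x $ (k mod dim_vec x))"

definition mat_vec :: "'a mat \<Rightarrow> 'a vec" where
  "mat_vec A =
     vec (dim_row A * dim_col A) (\<lambda>k. A $$ (k mod dim_row A, k div dim_row A))"

text \<open>The inverse of vectorization on the matrices of a fixed format, which is a bijection onto
  the vectors of the corresponding length (shown below).\<close>

definition mat_vec_inv :: "nat \<Rightarrow> nat \<Rightarrow> 'a vec \<Rightarrow> 'a mat" where
  "mat_vec_inv m n = the_inv_into (carrier_mat m n) mat_vec"

lemma stack_index_less: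
  fixes i j m n :: nat
  assumes "i < m" "j < n"
  shows "j * m + i < m * n"
proof -
  have "j * m + i < Suc j * m" using assms by simp
  also have "\<dots> \<le> n * m" using assms by (intro mult_le_mono1) simp
  finally show ?thesis by (simp add: mult.commute)
qed

lemma mat_vec_index:
  assumes "A \<in> carrier_mat m n" "i < m" "j < n"
  shows "mat_vec A $ (j * m + i) = A $$ (i, j)"
  using assms stack_index_less[of i m j n] by (auto simp: mat_vec_def)

lemma inj_on_mat_vec: "inj_on mat_vec (carrier_mat m n)"
proof (rule inj_onI)
  fix A B :: "'a mat"
  assume A: "A \<in> carrier_mat m n" and B: "B \<in> carrier_mat m n" and eq: "mat_vec A = mat_vec B"
  show "A = B"
  proof (rule eq_matI)
    fix i j assume "i < dim_row B" "j < dim_col B"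
    with B have ij: "i < m" "j < n" by auto
    show "A $$ (i, j) = B $$ (i, j)"
      using mat_vec_index[OF A ij] mat_vec_index[OF B ij] eq by simp
  qed (use A B in auto)
qed

lemma mat_vec_unstack:
  assumes "u \<in> carrier_vec (m * n)"
  shows "mat_vec (mat m n (\<lambda>(i, j). u $ (j * m + i))) = u"
proof (rule eq_vecI)
  fix k assume "k < dim_vec u"
  with assms have k: "k < m * n" by auto
  then have "m > 0" by (cases m) auto
  with k have "k mod m < m" "k div m < n"
    by (auto simp: less_mult_imp_div_less mult.commute)
  with k show "mat_vec (mat m n (\<lambda>(i, j). u $ (j * m + i))) $ k = u $ k"
    by (simp add: mat_vec_def)
qed (use assms in \<open>auto simp: mat_vec_def\<close>)

lemma bij_betw_mat_vec: "bij_betw mat_vec (carrier_mat m n) (carrier_vec (m * n))"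
  unfolding bij_betw_def
proof (intro conjI inj_on_mat_vec equalityI subsetI)
  fix u :: "'a vec" assume "u \<in> carrier_vec (m * n)"
  from mat_vec_unstack[OF this, symmetric]
  show "u \<in> mat_vec ` carrier_mat m n" by (rule image_eqI) simp
qed (auto simp: mat_vec_def)

lemma mat_vec_inv_eq:
  assumes "u \<in> carrier_vec (m * n)"
  shows "mat_vec_inv m n u = mat m n (\<lambda>(i, j). u $ (j * m + i))"
  unfolding mat_vec_inv_def
  by (rule the_inv_into_f_eq[OF inj_on_mat_vec mat_vec_unstack[OF assms]]) simp

end

theory Submission
  imports Defs
begin

text \<open>Vectorization turns the bilinear form of a matrix \<open>U\<close> into a scalar product:
  \<open>(y \<otimes> x) \<bullet> vec U = x \<bullet> (U y)\<close>.  So the system of bilinear equations says that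
  \<open>y \<otimes> x\<close> is orthogonal to every \<open>u\<^sub>i\<close>, hence, as the \<open>u\<^sub>i\<close> span the kernel of \<open>E\<^sup>T\<close>,
  that it is orthogonal to this whole kernel.  The theorem therefore reduces to the
  fundamental identity of linear algebra that the column space of \<open>E\<close> is the orthogonal
  complement of the kernel of \<open>E\<^sup>T\<close>.

  The nontrivial inclusion of that identity rests on orthogonal projection (lemma
  \<open>full_column_rank_least_squares\<close>): as the columns of \<open>E\<close> are independent, the Gram matrix
  \<open>E\<^sup>T E\<close> is invertible, so the normal equations \<open>E\<^sup>T E z = E\<^sup>T v\<close> have a solution and the
  residual \<open>v - E z\<close> lies in the kernel of \<open>E\<^sup>T\<close>.  If \<open>v\<close> is orthogonal to this kernel, the
  residual is orthogonal both to \<open>v\<close> and to \<open>E z\<close>, hence to itself, and so it vanishes.\<close>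

text \<open>Cutting the index range of the stack into blocks of length \<open>dim_vec x\<close> yields the double sum
  that defines the bilinear form.\<close>

lemma scalar_prod_kron_vec_mat_vec:
  fixes A :: "'a :: comm_semiring_1 mat"
  assumes A: "A \<in> carrier_mat m n" and x: "x \<in> carrier_vec m" and y: "y \<in> carrier_vec n"
  shows "kron_vec y x \<bullet> mat_vec A = x \<bullet> (A *\<^sub>v y)"
proof -
  let ?f = "\<lambda>k. y $ (k div m) * x $ (k mod m) * A $$ (k mod m, k div m)"
  have "kron_vec y x \<bullet> mat_vec A = (\<Sum>k<n * m. ?f k)"
    using A x y by (auto simp: scalar_prod_def kron_vec_def mat_vec_def mult.commute
        atLeast0LessThan intro!: sum.cong)
  also have "\<dots> = (\<Sum>j<n. sum ?f {j * m..<j * m + m})"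
    by (rule sum.nat_group[symmetric])
  also have "\<dots> = (\<Sum>j<n. \<Sum>i<m. ?f (j * m + i))"
    by (rule sum.cong[OF refl]) (subst sum.atLeastLessThan_shift_0, simp add: atLeast0LessThan)
  also have "\<dots> = (\<Sum>j<n. \<Sum>i<m. x $ i * (A $$ (i, j) * y $ j))"
    by (intro sum.cong) (auto simp: ac_simps)
  also have "\<dots> = (\<Sum>i<m. \<Sum>j<n. x $ i * (A $$ (i, j) * y $ j))"
    by (rule sum.swap)
  also have "\<dots> = x \<bullet> (A *\<^sub>v y)"
    using A x y by (auto simp: scalar_prod_def sum_distrib_left atLeast0LessThan intro!: sum.cong)
  finally show ?thesis .
qed

lemma mat_vec_mat_vec_inv:
  assumes "u \<in> carrier_vec (m * n)"
  shows "mat_vec (mat_vec_inv m n u) = u"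
  using assms by (simp add: mat_vec_inv_eq mat_vec_unstack)

text \<open>A list with a repetition has fewer than \<open>nc\<close> distinct members, too few to span a space of
  dimension \<open>nc\<close>.\<close>

lemma (in vec_space) full_column_rank_distinct_cols:
  assumes A: "A \<in> carrier_mat n nc" and rank: "rank A = nc"
  shows "distinct (cols A)"
proof -
  obtain S where S: "maximal S (\<lambda>T. T \<subseteq> set (cols A) \<and> lin_indpt T)"
    using maximal_exists_superset[of "set (cols A)" "\<lambda>T. T \<subseteq> set (cols A) \<and> lin_indpt T" "{}"]
      finite_lin_indpt2[of "{}"] by auto
  have "nc = card S" using rank_card_indpt[OF A S] rank by simp
  also have "\<dots> \<le> card (set (cols A))" using S by (auto simp: maximal_def intro: card_mono)
  finally have "card (set (cols A)) = length (cols A)"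
    using A card_length[of "cols A"] by simp
  then show ?thesis by (rule card_distinct)
qed

lemma (in vec_space) full_column_rank_kernel_trivial:
  assumes A: "A \<in> carrier_mat n nc" and rank: "rank A = nc"
    and z: "z \<in> carrier_vec nc" and Az: "A *\<^sub>v z = 0\<^sub>v n"
  shows "z = 0\<^sub>v nc"
proof (rule ccontr)
  note dist = full_column_rank_distinct_cols[OF A rank]
  assume "z \<noteq> 0\<^sub>v nc"
  then have "lin_dep (set (cols A))" using lin_depI[OF A z _ Az dist] by blast
  with full_rank_lin_indpt[OF A rank dist] show False by blast
qed

lemma scalar_prod_self_eq_0_real:
  fixes v :: "real vec"
  assumes "v \<in> carrier_vec n" "v \<bullet> v = 0"
  shows "v = 0\<^sub>v n"
proof -
  have "conjugate v = v" by (intro eq_vecI) simp_all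
  with conjugate_square_eq_0_vec[OF assms(1)] assms(2) show ?thesis by simp
qed

text \<open>If \<open>E\<^sup>T E z = 0\<close>, then \<open>E z \<bullet> E z = z \<bullet> E\<^sup>T E z = 0\<close>, so \<open>E z = 0\<close> and \<open>z = 0\<close>.\<close>

lemma full_column_rank_gram_det:
  fixes E :: "real mat"
  assumes E: "E \<in> carrier_mat n r" and rank: "vec_space.rank n E = r"
  shows "det (transpose_mat E * E) \<noteq> 0"
proof
  have G: "transpose_mat E * E \<in> carrier_mat r r" using E by simp
  assume "det (transpose_mat E * E) = 0"
  then obtain z where z: "z \<in> carrier_vec r" "z \<noteq> 0\<^sub>v r"
    and Gz: "(transpose_mat E * E) *\<^sub>v z = 0\<^sub>v r"
    using det_0_iff_vec_prod_zero_field[OF G] by blast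
  have Ez: "E *\<^sub>v z \<in> carrier_vec n" using E z by simp
  have "transpose_mat E *\<^sub>v (E *\<^sub>v z) = 0\<^sub>v r"
    using Gz assoc_mult_mat_vec[of "transpose_mat E" r n E r z] E z by simp
  then have "(E *\<^sub>v z) \<bullet> (E *\<^sub>v z) = 0"
    using transpose_vec_mult_scalar[OF E z(1) Ez] z by simp
  then have "E *\<^sub>v z = 0\<^sub>v n" by (rule scalar_prod_self_eq_0_real[OF Ez])
  then have "z = 0\<^sub>v r" by (rule vec_space.full_column_rank_kernel_trivial[OF E rank z(1)])
  with z(2) show False by contradiction
qed

lemma full_column_rank_least_squares:
  fixes E :: "real mat"
  assumes E: "E \<in> carrier_mat n r" and rank: "vec_space.rank n E = r"
    and v: "v \<in> carrier_vec n"
  obtains z where "z \<in> carrier_vec r" "v - E *\<^sub>v z \<in> mat_kernel (transpose_mat E)"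
proof -
  let ?Et = "transpose_mat E"
  have Et: "?Et \<in> carrier_mat r n" and G: "?Et * E \<in> carrier_mat r r" using E by simp_all
  obtain B where B: "B \<in> carrier_mat r r" and inv: "?Et * E * B = 1\<^sub>m r"
    using det_non_zero_imp_unit[OF G full_column_rank_gram_det[OF E rank], of undefined]
    by (auto simp: Units_def ring_mat_simps)
  define z where "z = B *\<^sub>v (?Et *\<^sub>v v)"
  have Etv: "?Et *\<^sub>v v \<in> carrier_vec r" using Et v by simp
  have z: "z \<in> carrier_vec r" using B Etv by (simp add: z_def)
  have Ez: "E *\<^sub>v z \<in> carrier_vec n" using E z by simp
  have "?Et *\<^sub>v (E *\<^sub>v z) = (?Et * E) *\<^sub>v z"
    using assoc_mult_mat_vec[OF Et E z] by simp
  also have "\<dots> = (?Et * E * B) *\<^sub>v (?Et *\<^sub>v v)"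
    unfolding z_def using assoc_mult_mat_vec[OF G B Etv] by simp
  also have "\<dots> = ?Et *\<^sub>v v" using inv Etv by simp
  finally have "?Et *\<^sub>v (v - E *\<^sub>v z) = 0\<^sub>v r"
    using mult_minus_distrib_mat_vec[OF Et v Ez] Etv by simp
  then have "v - E *\<^sub>v z \<in> mat_kernel ?Et" using Et v Ez by (intro mat_kernelI) auto
  with z show thesis by (rule that)
qed

lemma full_column_rank_col_space_eq:
  fixes E :: "real mat"
  assumes E: "E \<in> carrier_mat n r" and rank: "vec_space.rank n E = r"
  shows "vec_space.col_space n E =
    vec_module.orthogonal_complement n (mat_kernel (transpose_mat E))"
proof (intro equalityI subsetI)
  have Et: "transpose_mat E \<in> carrier_mat r n" using E by simp
  fix v
  {
    assume "v \<in> vec_space.col_space n E"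
    then obtain z where z: "z \<in> carrier_vec r" and v: "v = E *\<^sub>v z"
      using vec_space.col_space_eq[OF E] E by auto
    have vc: "v \<in> carrier_vec n" using E z v by simp
    have "v \<bullet> w = 0" if "w \<in> mat_kernel (transpose_mat E)" for w
    proof -
      note w = mat_kernelD[OF Et that]
      have "v \<bullet> w = w \<bullet> (E *\<^sub>v z)" using comm_scalar_prod[OF vc w(1)] v by simp
      also have "\<dots> = 0" using transpose_vec_mult_scalar[OF E z w(1)] w(2) z by simp
      finally show ?thesis .
    qed
    with vc show "v \<in> vec_module.orthogonal_complement n (mat_kernel (transpose_mat E))"
      by (simp add: vec_module.orthogonal_complement_def)
  next
    assume "v \<in> vec_module.orthogonal_complement n (mat_kernel (transpose_mat E))"
    then have v: "v \<in> carrier_vec n"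
      and orth: "\<And>w. w \<in> mat_kernel (transpose_mat E) \<Longrightarrow> v \<bullet> w = 0"
      by (auto simp: vec_module.orthogonal_complement_def)
    obtain z where z: "z \<in> carrier_vec r" and ker: "v - E *\<^sub>v z \<in> mat_kernel (transpose_mat E)"
      using full_column_rank_least_squares[OF E rank v] .
    define w where "w = v - E *\<^sub>v z"
    have Ez: "E *\<^sub>v z \<in> carrier_vec n" using E z by simp
    note w = mat_kernelD[OF Et ker[folded w_def]]
    have "(E *\<^sub>v z) \<bullet> w = 0"
      using transpose_vec_mult_scalar[OF E z w(1)] w(2) z comm_scalar_prod[OF Ez w(1)] by simp
    moreover have "v \<bullet> w = 0" using orth ker by (simp add: w_def)
    ultimately have "w \<bullet> w = 0"
      using minus_scalar_prod_distrib[OF v Ez w(1)] by (simp add: w_def)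
    then have "w = 0\<^sub>v n" by (rule scalar_prod_self_eq_0_real[OF w(1)])
    then have "E *\<^sub>v z = v"
    proof (intro eq_vecI)
      fix k assume "w = 0\<^sub>v n" "k < dim_vec v"
      then have "(v - E *\<^sub>v z) $ k = 0" "k < n" using v by (auto simp: w_def)
      then show "(E *\<^sub>v z) $ k = v $ k" using Ez E by auto
    qed (use E v in auto)
    then show "v \<in> vec_space.col_space n E"
      using vec_space.col_space_eq[OF E] E v z by auto
  }
qed

lemma (in kernel) orthogonal_complement_basis:
  assumes "basis B"
  shows "NC.orthogonal_complement B = NC.orthogonal_complement (mat_kernel A)"
proof -
  have B: "B \<subseteq> mat_kernel A" and span: "span B = mat_kernel A"
    using assms by (auto simp: Ker.basis_def)
  have "B \<subseteq> carrier_vec nc" using B mat_kernel_carrier[OF A] by blast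
  then show ?thesis
    using NC.in_orthogonal_complement_span[of B] span span_same[OF B] by metis
qed

theorem theorem3p3:
  fixes I J R :: nat
    and E :: "real mat"
    and u :: "nat \<Rightarrow> real vec"
    and U :: "nat \<Rightarrow> real mat"
    and x y :: "real vec"
  assumes "I > 0" and "J > 0" and "R > 0"
    and "E \<in> carrier_mat (I * J) R"
    and "vec_space.rank (I * J) E = R"
    and "inj_on u {1..I * J - R}"
    and "kernel.basis (I * J) (transpose_mat E) (u ` {1..I * J - R})"
    and "\<And>i. i \<in> {1..I * J - R} \<Longrightarrow> U i = mat_vec_inv I J (u i)"
    and "x \<in> carrier_vec I" and "y \<in> carrier_vec J"
  shows "kron_vec y x \<in> vec_space.col_space (I * J) E \<longleftrightarrow>
    (\<forall>i\<in>{1..I * J - R}. x \<bullet> (U i *\<^sub>v y) = 0)"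
proof -
  let ?K = "mat_kernel (transpose_mat E)" and ?S = "{1..I * J - R}"
  note E = assms(4) and x = assms(9) and y = assms(10)
  interpret kernel R "I * J" "transpose_mat E" by unfold_locales (use E in simp)
  have "u ` ?S \<subseteq> ?K" using assms(7) by (simp add: Ker.basis_def)
  then have u: "u i \<in> carrier_vec (I * J)" if "i \<in> ?S" for i
    using that mat_kernel_carrier[OF A] by blast
  have form: "kron_vec y x \<bullet> u i = x \<bullet> (U i *\<^sub>v y)" if i: "i \<in> ?S" for i
  proof -
    have "U i \<in> carrier_mat I J" using assms(8)[OF i] mat_vec_inv_eq[OF u[OF i]] by simp
    moreover have "mat_vec (U i) = u i" using assms(8)[OF i] mat_vec_mat_vec_inv[OF u[OF i]] by simp
    ultimately show ?thesis using scalar_prod_kron_vec_mat_vec[of "U i" I J x y] x y by simp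
  qed
  have "kron_vec y x \<in> carrier_vec (I * J)"
    using x y by (intro carrier_vecI) (simp add: kron_vec_def)
  then have "kron_vec y x \<in> NC.orthogonal_complement (u ` ?S) \<longleftrightarrow>
      (\<forall>i\<in>?S. kron_vec y x \<bullet> u i = 0)"
    by (simp add: NC.orthogonal_complement_def)
  moreover have "NC.orthogonal_complement (u ` ?S) = NC.col_space E"
    using orthogonal_complement_basis[OF assms(7)] full_column_rank_col_space_eq[OF E assms(5)]
    by simp
  ultimately show ?thesis using form by simp
qed

end
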